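(* Let $X$ be a complete set in a metric space $(Y,d)$. Let $F\colon X\to 2^{Y}$ be an $\alpha$-contraction such that each $x\in X$ has a nearest point in $F(x)$ (i.e. a $t\in F(x)$ with $d(x,t)=d(x,F(x))$) and such a point belongs to $\tilde{I}_{X}(x)$. Then for each $\epsilon>0$ the following is satisfied: for each $x\in X\setminus F(x)$ there exists a $z\in X\setminus\{x\}$ such that $$(1-\alpha-\epsilon)\,d(x,z)\le d(x,F(x))-d(z,F(z)),$$ and consequently, $F$ has a fixed point.
   Context: $2^{Y}$ is the family of all subsets of $Y$; a mapping $F\colon X\to 2^{Y}$ is understood to satisfy $X\neq\emptyset$ and $F(x)\neq\emptyset$ for all $x\in X$. "For each $x\in X\setminus F(x)$" means for each $x\in X$ with $x\notin F(x)$. For a nonempty $A\subset Y$, $d(x,A)=d(A,x)=\inf_{a\in A}d(x,a)$. For nonempty $A,B\subset Y$, $D(A,B)=\max\{\sup_{a\in A}d(a,B),\sup_{b\in B}d(A,b)\}$ whenever this is finite (Hausdorff distance). For $0\le\alpha<1$, $F$ is an $\alpha$-contraction if $D(F(y),F(x))\le\alpha\,d(y,x)$ (in particular, $D(F(y),F(x))$ is finite) for all $x,y\in X$; values of $F$ are not assumed closed. A fixed point of $F$ is an $x\in X$ with $x\in F(x)$. For $x,t\in Y$ the metric segment is $[x,t]=\{s\in Y\colon d(x,s)+d(s,t)=d(x,t)\}$, and $(x,t]=[x,t]\setminus\{x\}$. For nonempty $X\subset Y$ and $x\in X$, the generalized inward set is $$\tilde{I}_{X}(x)=\{x\}\cup\{t\in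 Y\colon \text{for each }\beta>0\text{ there exist } s\in(x,t]\text{ and } z\in X\text{ such that } d(z,s)\le\beta\,d(x,s)\}.$$ *)

theory Defs
  imports "HOL-Analysis.Analysis"
begin

text \<open>The metric space \<open>Y\<close> is the universe of a type of class \<open>metric_space\<close>.
  For nonempty \<open>A\<close>, the library constant \<open>infdist x A\<close> is \<open>d(x,A)\<close>.\<close>

text \<open>Meaningful for nonempty sets only. The value is \<open>\<infinity>\<close> exactly when one of the two
  suprema is not finite, so a real upper bound on \<open>hausdorff_dist A B\<close> includes the
  assertion that the Hausdorff distance is finite.\<close>

definition hausdorff_dist :: "'a::metric_space set \<Rightarrow> 'a set \<Rightarrow> ereal" where
  "hausdorff_dist A B =
     max (SUP a\<in>A. ereal (infdist a B)) (SUP b\<in>B. ereal (infdist b A))"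

definition contraction_mv :: "real \<Rightarrow> 'a::metric_space set \<Rightarrow> ('a \<Rightarrow> 'a set) \<Rightarrow> bool" where
  "contraction_mv \<alpha> X F \<longleftrightarrow> 0 \<le> \<alpha> \<and> \<alpha> < 1 \<and>
     (\<forall>x\<in>X. \<forall>y\<in>X. hausdorff_dist (F y) (F x) \<le> ereal (\<alpha> * dist y x))"

definition nearest_point :: "'a::metric_space \<Rightarrow> 'a set \<Rightarrow> 'a \<Rightarrow> bool" where
  "nearest_point x A t \<longleftrightarrow> t \<in> A \<and> dist x t = infdist x A"

definition metric_segment :: "'a::metric_space \<Rightarrow> 'a \<Rightarrow> 'a set" where
  "metric_segment x t = {s. dist x s + dist s t = dist x t}"

definition metric_segment_left_open :: "'a::metric_space \<Rightarrow> 'a \<Rightarrow> 'a set" where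
  "metric_segment_left_open x t = metric_segment x t - {x}"

definition gen_inward_set :: "'a::metric_space set \<Rightarrow> 'a \<Rightarrow> 'a set" where
  "gen_inward_set X x = {x} \<union>
     {t. \<forall>\<beta>>0. \<exists>s\<in>metric_segment_left_open x t. \<exists>z\<in>X. dist z s \<le> \<beta> * dist x s}"

end

theory Submission
  imports Defs
begin

text \<open>
  Starting from \<open>x \<notin> F x\<close>, take a nearest point \<open>t\<close> of \<open>F x\<close> and walk towards it. A point \<open>s\<close> of the
  metric segment from \<open>x\<close> to \<open>t\<close> is closer to \<open>t\<close> than \<open>x\<close> is, by exactly \<open>dist x s\<close>, and the
  inwardness condition provides \<open>z \<in> X\<close> whose distance to \<open>s\<close> is negligible relative to \<open>dist x s\<close>.
  Replacing \<open>s\<close> by \<open>z\<close> costs only this small error, and replacing \<open>F x\<close> by \<open>F z\<close> costs at most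
  \<open>\<alpha> * dist x z\<close>. Hence the displacement \<open>\<lambda>x. infdist x (F x)\<close> drops by almost
  \<open>(1 - \<alpha>) * dist x z\<close> (lemma \<open>displacement_decrease\<close>).

  The fixed point comes from this decrease by Ekeland's variational principle
  (\<open>ekeland_variational_principle\<close>): the displacement is nonnegative and continuous on the complete
  set \<open>X\<close>, so for every slope \<open>c > 0\<close> some \<open>x \<in> X\<close> admits no \<open>z \<noteq> x\<close> at which it is lower by
  at least \<open>c * dist x z\<close>. For \<open>c = (1 - \<alpha>) / 2\<close> such an \<open>x\<close> has to be a fixed point.
\<close>

text \<open>
  The relation \<open>c * dist x z \<le> f x - f z\<close> is a partial order, read as \<open>z\<close> lying below \<open>x\<close>; a minimal
  element is wanted. A descending sequence that nearly minimises \<open>f\<close> below its current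
  element at each step is Cauchy, because \<open>f\<close> decreases along it and is bounded below. Its limit
  lies below all of its members, so anything below the limit has the same value of \<open>f\<close> and is
  therefore the limit itself. The closed sublevel sets express lower semicontinuity of \<open>f\<close> on \<open>X\<close>.
\<close>

lemma ekeland_variational_principle:
  fixes f :: "'a::metric_space \<Rightarrow> real"
  assumes "complete X" and "X \<noteq> {}" and "c > 0"
    and bdd: "bdd_below (f ` X)"
    and lsc: "\<And>r. closedin (top_of_set X) {x \<in> X. f x \<le> r}"
  obtains x where "x \<in> X" and "\<And>z. z \<in> X \<Longrightarrow> c * dist x z \<le> f x - f z \<Longrightarrow> z = x"
proof -
  define S where "S x = {z \<in> X. c * dist x z \<le> f x - f z}" for x
  have S_trans: "z \<in> S x" if "y \<in> S x" "z \<in> S y" for x y z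
  proof -
    have "c * dist x z \<le> c * (dist x y + dist y z)"
      using \<open>c > 0\<close> dist_triangle by simp
    then show ?thesis using that by (auto simp: S_def algebra_simps)
  qed
  have near_inf: "\<exists>y. y \<in> X \<and> y \<in> S x \<and> (\<forall>z\<in>S x. f y \<le> f z + inverse (real (Suc n)))"
    if "x \<in> X" for x n
  proof -
    have ne: "f ` S x \<noteq> {}" using that by (auto simp: S_def)
    have bdd_S: "bdd_below (f ` S x)" by (rule bdd_below_mono[OF bdd]) (auto simp: S_def)
    obtain y where y: "y \<in> S x" "f y < Inf (f ` S x) + inverse (real (Suc n))"
      using cInf_lessD[OF ne, of "Inf (f ` S x) + inverse (real (Suc n))"] by auto
    have "f y \<le> f z + inverse (real (Suc n))" if "z \<in> S x" for z
      using y cInf_lower[OF imageI[OF that] bdd_S] by linarith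
    then show ?thesis using y by (auto simp: S_def)
  qed
  obtain u where u_X: "\<And>n. u n \<in> X"
    and u_Suc: "\<And>n. u (Suc n) \<in> S (u n)"
    and u_min: "\<And>n z. z \<in> S (u n) \<Longrightarrow> f (u (Suc n)) \<le> f z + inverse (real (Suc n))"
    using dependent_nat_choice[where P = "\<lambda>_ x. x \<in> X"
        and Q = "\<lambda>n x y. y \<in> S x \<and> (\<forall>z\<in>S x. f y \<le> f z + inverse (real (Suc n)))"]
      near_inf \<open>X \<noteq> {}\<close> by (metis ex_in_conv)
  have u_S: "u m \<in> S (u n)" if "n \<le> m" for m n
    using that
  proof (induction m rule: dec_induct)
    case base
    then show ?case using u_X by (simp add: S_def)
  next
    case (step m)
    then show ?case using S_trans u_Suc by blast
  qed
  have dist_u: "c * dist (u n) (u m) \<le> f (u n) - f (u m)" if "n \<le> m" for m n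
    using u_S[OF that] by (simp add: S_def)
  have f_dec: "f (u m) \<le> f (u n)" if "n \<le> m" for m n
    using dist_u[OF that] \<open>c > 0\<close> zero_le_dist[of "u n" "u m"]
    by (smt (verit) mult_nonneg_nonneg)
  obtain B where "\<And>x. x \<in> X \<Longrightarrow> B \<le> f x"
    using bdd by (auto simp: bdd_below_def)
  then have "\<And>n. B \<le> f (u n)" using u_X by blast
  moreover have "decseq (\<lambda>n. f (u n))"
    using f_dec by (simp add: decseq_def)
  ultimately obtain L where "(\<lambda>n. f (u n)) \<longlonglongrightarrow> L"
    using decseq_convergent by blast
  then have f_Cauchy: "Cauchy (\<lambda>n. f (u n))"
    by (rule LIMSEQ_imp_Cauchy)
  have "Cauchy u"
  proof (rule metric_CauchyI)
    fix e :: real assume "e > 0"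
    then have "c * e > 0" using \<open>c > 0\<close> by simp
    then obtain M where M: "\<And>m n. m \<ge> M \<Longrightarrow> n \<ge> M \<Longrightarrow> dist (f (u m)) (f (u n)) < c * e"
      using metric_CauchyD[OF f_Cauchy] by meson
    have ordered: "dist (u n) (u m) < e" if "n \<ge> M" "n \<le> m" for m n
    proof -
      have "c * dist (u n) (u m) < c * e"
        using dist_u[OF \<open>n \<le> m\<close>] M[of n m] that by (auto simp: dist_real_def)
      then show ?thesis using \<open>c > 0\<close> by simp
    qed
    show "\<exists>M. \<forall>m\<ge>M. \<forall>n\<ge>M. dist (u m) (u n) < e"
      using ordered by (metis dist_commute nle_le)
  qed
  then obtain x where "x \<in> X" and lim: "u \<longlonglongrightarrow> x"
    using \<open>complete X\<close> u_X by (auto simp: complete_def)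
  have f_x: "f x \<le> f (u n)" for n
  proof -
    obtain T where "closed T" and T: "{x \<in> X. f x \<le> f (u n)} = X \<inter> T"
      using lsc[of "f (u n)"] by (auto simp: closedin_closed)
    have "u (k + n) \<in> T" for k
      using u_X f_dec[of n "k + n"] T by auto
    then have "x \<in> T"
      by (rule closed_sequentially[OF \<open>closed T\<close> _ LIMSEQ_ignore_initial_segment[OF lim, of n]])
    then show ?thesis using \<open>x \<in> X\<close> T by blast
  qed
  have x_S: "x \<in> S (u n)" for n
  proof -
    have "(\<lambda>m. c * dist (u n) (u m)) \<longlonglongrightarrow> c * dist (u n) x"
      by (intro tendsto_intros lim)
    moreover have "\<forall>m\<ge>n. c * dist (u n) (u m) \<le> f (u n) - f x"
      using dist_u f_x by (smt (verit))
    ultimately have "c * dist (u n) x \<le> f (u n) - f x"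
      by (blast intro: LIMSEQ_le_const2)
    then show ?thesis using \<open>x \<in> X\<close> by (simp add: S_def)
  qed
  have "z = x" if "z \<in> X" "c * dist x z \<le> f x - f z" for z
  proof -
    have "z \<in> S x" using that by (simp add: S_def)
    then have "f x \<le> f z + inverse (real (Suc n))" for n
      using u_min[OF S_trans[OF x_S]] f_x order_trans by blast
    then have "f x \<le> f z"
      using LIMSEQ_le_const[OF LIMSEQ_inverse_real_of_nat_add] by blast
    then have "c * dist x z \<le> 0" using that by linarith
    then show "z = x" using \<open>c > 0\<close> by (simp add: mult_le_0_iff)
  qed
  then show thesis using \<open>x \<in> X\<close> that by blast
qed

lemma contraction_mv_infdist_le:
  assumes "contraction_mv \<alpha> X F" and "x \<in> X" and "z \<in> X" and "t \<in> F x"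
  shows "infdist t (F z) \<le> \<alpha> * dist x z"
proof -
  have "ereal (infdist t (F z)) \<le> hausdorff_dist (F x) (F z)"
    unfolding hausdorff_dist_def using \<open>t \<in> F x\<close>
    by (intro max.coboundedI1) (rule SUP_upper)
  also have "\<dots> \<le> ereal (\<alpha> * dist x z)"
    using assms by (auto simp: contraction_mv_def)
  finally show ?thesis by simp
qed

lemma infdist_value_le:
  assumes "contraction_mv \<alpha> X F" and "x \<in> X" and "z \<in> X" and "t \<in> F x"
  shows "infdist z (F z) \<le> dist z t + \<alpha> * dist x z"
  using infdist_triangle[of z "F z" t] contraction_mv_infdist_le[OF assms] by linarith

lemma displacement_lipschitz:
  assumes F: "contraction_mv \<alpha> X F"
    and ne: "\<And>x. x \<in> X \<Longrightarrow> F x \<noteq> {}"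
  shows "(1 + \<alpha>)-lipschitz_on X (\<lambda>x. infdist x (F x))"
proof (rule lipschitz_onI)
  have one_sided: "infdist z (F z) \<le> infdist x (F x) + (1 + \<alpha>) * dist x z"
    if "x \<in> X" "z \<in> X" for x z
  proof -
    have "infdist z (F z) - (1 + \<alpha>) * dist x z \<le> dist x t" if "t \<in> F x" for t
      using infdist_value_le[OF F \<open>x \<in> X\<close> \<open>z \<in> X\<close> that] dist_triangle3[of z t x]
      by (simp add: algebra_simps)
    then have "infdist z (F z) - (1 + \<alpha>) * dist x z \<le> infdist x (F x)"
      unfolding infdist_notempty[OF ne[OF \<open>x \<in> X\<close>]]
      by (rule cINF_greatest[OF ne[OF \<open>x \<in> X\<close>]])
    then show ?thesis by simp
  qed
  show "dist (infdist x (F x)) (infdist y (F y)) \<le> (1 + \<alpha>) * dist x y"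
    if "x \<in> X" "y \<in> X" for x y
    using one_sided[OF that] one_sided[OF that(2,1)]
    by (simp add: dist_real_def dist_commute abs_le_iff)
  show "0 \<le> 1 + \<alpha>"
    using F by (simp add: contraction_mv_def)
qed

text \<open>
  Writing \<open>h\<close> for \<open>dist z s\<close>, the equality in the segment gives
  \<open>dist z t \<le> h + dist x t - dist x s \<le> dist x t - dist x z + 2 * h\<close>, so it suffices that
  \<open>2 * h \<le> \<epsilon> * dist x z\<close>. The inwardness condition bounds \<open>h\<close> by \<open>\<beta> * dist x s\<close> instead;
  as \<open>dist x s \<le> dist x z + h\<close>, this yields \<open>h \<le> \<beta> / (1 - \<beta>) * dist x z\<close>, and
  \<open>\<beta> / (1 - \<beta>) = \<epsilon> / 2\<close> holds for \<open>\<beta> = \<epsilon> / (2 + \<epsilon>)\<close>.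
\<close>

lemma displacement_decrease:
  assumes F: "contraction_mv \<alpha> X F" and "x \<in> X" and "x \<notin> F x" and "\<epsilon> > 0"
    and t: "nearest_point x (F x) t" "t \<in> gen_inward_set X x"
  shows "\<exists>z\<in>X - {x}. (1 - \<alpha> - \<epsilon>) * dist x z \<le> infdist x (F x) - infdist z (F z)"
proof -
  have "t \<in> F x" and dist_t: "dist x t = infdist x (F x)"
    using t(1) by (auto simp: nearest_point_def)
  then have "t \<noteq> x" using \<open>x \<notin> F x\<close> by blast
  have "\<epsilon> / (2 + \<epsilon>) > 0" using \<open>\<epsilon> > 0\<close> by simp
  then obtain s z where s: "s \<in> metric_segment_left_open x t"
    and "z \<in> X" and z: "dist z s \<le> \<epsilon> / (2 + \<epsilon>) * dist x s"
    using t(2) \<open>t \<noteq> x\<close> unfolding gen_inward_set_def by blast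
  have "s \<noteq> x" and seg: "dist x s + dist s t = dist x t"
    using s by (auto simp: metric_segment_left_open_def metric_segment_def)
  have "(2 + \<epsilon>) * dist z s \<le> \<epsilon> * dist x s"
    using z \<open>\<epsilon> > 0\<close> by (simp add: field_simps)
  also have "\<dots> \<le> \<epsilon> * (dist x z + dist z s)"
    using \<open>\<epsilon> > 0\<close> by (simp add: dist_triangle)
  finally have small: "2 * dist z s \<le> \<epsilon> * dist x z"
    by (simp add: algebra_simps)
  have "z \<noteq> x"
    using small \<open>s \<noteq> x\<close> by auto
  have "infdist z (F z) \<le> dist z t + \<alpha> * dist x z"
    using infdist_value_le[OF F \<open>x \<in> X\<close> \<open>z \<in> X\<close> \<open>t \<in> F x\<close>] .
  moreover have "dist z t \<le> dist z s + dist s t" "dist x z \<le> dist x s + dist z s"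
    by (rule dist_triangle dist_triangle2)+
  ultimately have "dist x z - \<alpha> * dist x z - \<epsilon> * dist x z \<le> infdist x (F x) - infdist z (F z)"
    using seg dist_t small by linarith
  then show ?thesis
    using \<open>z \<in> X\<close> \<open>z \<noteq> x\<close> by (auto simp: algebra_simps)
qed

theorem theorem3p6:
  fixes X :: "'a::metric_space set" and F :: "'a \<Rightarrow> 'a set" and \<alpha> :: real
  assumes "complete X"
    and "X \<noteq> {}"
    and "\<And>x. x \<in> X \<Longrightarrow> F x \<noteq> {}"
    and "contraction_mv \<alpha> X F"
    and "\<And>x. x \<in> X \<Longrightarrow> \<exists>t. nearest_point x (F x) t \<and> t \<in> gen_inward_set X x"
  shows "(\<forall>\<epsilon>>0. \<forall>x\<in>X. x \<notin> F x \<longrightarrow>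
            (\<exists>z\<in>X - {x}. (1 - \<alpha> - \<epsilon>) * dist x z \<le> infdist x (F x) - infdist z (F z)))
         \<and> (\<exists>x\<in>X. x \<in> F x)"
proof
  show decrease: "\<forall>\<epsilon>>0. \<forall>x\<in>X. x \<notin> F x \<longrightarrow>
      (\<exists>z\<in>X - {x}. (1 - \<alpha> - \<epsilon>) * dist x z \<le> infdist x (F x) - infdist z (F z))"
    using displacement_decrease[OF assms(4)] assms(5) by metis
  define f where "f x = infdist x (F x)" for x
  define c where "c = (1 - \<alpha>) / 2"
  have "c > 0"
    using assms(4) by (simp add: c_def contraction_mv_def)
  have "continuous_on X f"
    using displacement_lipschitz[OF assms(4,3)] lipschitz_on_continuous_on
    unfolding f_def by blast
  then have "closedin (top_of_set X) {x \<in> X. f x \<le> r}" for r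
    using continuous_closedin_preimage[of X f "{..r}"] by (simp add: vimage_def Int_def)
  moreover have "bdd_below (f ` X)"
    by (rule bdd_belowI[of _ 0]) (auto simp: f_def infdist_nonneg)
  ultimately obtain x where "x \<in> X"
    and minimal: "\<And>z. z \<in> X \<Longrightarrow> c * dist x z \<le> f x - f z \<Longrightarrow> z = x"
    using ekeland_variational_principle[OF assms(1,2) \<open>c > 0\<close>] by metis
  have "x \<in> F x"
  proof (rule ccontr)
    assume "x \<notin> F x"
    moreover have "1 - \<alpha> - c = c" by (simp add: c_def field_simps)
    ultimately obtain z where "z \<in> X - {x}" "c * dist x z \<le> f x - f z"
      using decrease \<open>c > 0\<close> \<open>x \<in> X\<close> unfolding f_def by metis
    then show False using minimal by blast
  qed
  then show "\<exists>x\<in>X. x \<in> F x" using \<open>x \<in> X\<close> by blast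
qed

end
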